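(* Let $p$ be an odd prime and $n$ a positive integer. Let $x,y$ be integers with $1\le x\le p-1$, $0\le y\le np-1$ and $1\le x+yp\le np^2-1$. For $1\le i\le p$ put $d_i=(i-1)xpn+x+yp$ and let $R_i\subseteq\mathbb{Z}_{np^3}$ be the set of residues modulo $np^3$ of $$p,\ d_i,\ np^2-d_i,\ np^2+d_i,\ 2np^2-d_i,\ 2np^2+d_i,\ \dots,\ (p-1)np^2-d_i,\ (p-1)np^2+d_i,\ np^3-d_i,\ np^3-p.$$ Then for all $1\le i,j\le p$, $\Theta_{np^3,p,jn}(C_{np^3}(R_i))=C_{np^3}(R_{i+j})$, where the index $i+j$ is reduced modulo $p$ to a value in $\{1,\dots,p\}$; and the $p$ graphs $C_{np^3}(R_1),\dots,C_{np^3}(R_p)$ are Type-2 isomorphic with respect to $p$ (any two with different indices are Type-2 isomorphic with respect to $p$).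
   Context: For a positive integer $N$ and $R\subseteq\mathbb{Z}_N$ with $R=-R$, the circulant graph $C_N(R)$ has vertex set $\mathbb{Z}_N$, with $u,v$ adjacent iff $u-v\in R$. $C_N(R)$ and $C_N(S)$ are Adam's isomorphic if $S=aR \pmod N$ for some $a$ with $\gcd(a,N)=1$. For an integer $r$ with $\gcd(N,r)=m>1$ and $0\le t\le N/m-1$, $\Theta_{N,r,t}:\mathbb{Z}_N\to\mathbb{Z}_N$ is the bijection $u\mapsto u+jtm\pmod N$ where $u=qm+j$, $0\le j\le m-1$; for a graph $G$ on $\mathbb{Z}_N$, $\Theta_{N,r,t}(G)$ is the graph on $\mathbb{Z}_N$ with edges $\{\Theta_{N,r,t}(u),\Theta_{N,r,t}(v)\}$ for edges $\{u,v\}$ of $G$. $C_N(R)$ and $C_N(S)$ are Type-2 isomorphic with respect to $r$ if $R\ne S$, $|R|=|S|\ge 3$, $\Theta_{N,r,t}(C_N(R))=C_N(S)$ for some $1\le t\le N/m-1$, and $S\neq aR\pmod N$ for all $a$ with $\gcd(a,N)=1$. *)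

theory Defs
  imports "HOL-Computational_Algebra.Primes"
begin

text \<open>
  The ring of residues modulo \<open>N\<close> is represented by the set \<open>{0..<N}\<close> of integers. An undirected
  graph is a pair of its vertex set and its edge set, an edge being an unordered pair \<open>{u, v}\<close>
  (a singleton if it is a loop, which for circulant graphs means that \<open>0\<close> lies in the connection
  set).
\<close>

definition residue_set :: "int \<Rightarrow> int set" where
  "residue_set N = {0..<N}"

definition connection_set :: "int \<Rightarrow> int set \<Rightarrow> bool" where
  "connection_set N R \<longleftrightarrow> R \<subseteq> residue_set N \<and> R = (\<lambda>s. (- s) mod N) ` R"

type_synonym 'a ugraph = "'a set \<times> 'a set set"

definition circulant_graph :: "int \<Rightarrow> int set \<Rightarrow> int ugraph" where
  "circulant_graph N R =
     (residue_set N,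
      {{u, v} | u v. u \<in> residue_set N \<and> v \<in> residue_set N \<and> (u - v) mod N \<in> R})"

definition adam_isomorphic :: "int \<Rightarrow> int set \<Rightarrow> int set \<Rightarrow> bool" where
  "adam_isomorphic N R S \<longleftrightarrow> (\<exists>a. coprime a N \<and> S = (\<lambda>s. (a * s) mod N) ` R)"

text \<open>
  In the decomposition \<open>u = q * m + j\<close> with \<open>0 \<le> j \<le> m - 1\<close> one has \<open>j = u mod m\<close>.
\<close>

definition Theta :: "int \<Rightarrow> int \<Rightarrow> int \<Rightarrow> int \<Rightarrow> int" where
  "Theta N r t u = (let m = gcd N r in (u + (u mod m) * t * m) mod N)"

definition Theta_graph :: "int \<Rightarrow> int \<Rightarrow> int \<Rightarrow> int ugraph \<Rightarrow> int ugraph" where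
  "Theta_graph N r t G =
     (residue_set N, {{Theta N r t u, Theta N r t v} | u v. {u, v} \<in> snd G})"

definition type2_isomorphic :: "int \<Rightarrow> int \<Rightarrow> int set \<Rightarrow> int set \<Rightarrow> bool" where
  "type2_isomorphic N r R S \<longleftrightarrow>
     N > 0 \<and> connection_set N R \<and> connection_set N S \<and> gcd N r > 1 \<and>
     R \<noteq> S \<and> card R = card S \<and> card R \<ge> 3 \<and>
     (\<exists>t. 1 \<le> t \<and> t \<le> N div gcd N r - 1 \<and>
          Theta_graph N r t (circulant_graph N R) = circulant_graph N S) \<and>
     \<not> adam_isomorphic N R S"

definition shift_d :: "int \<Rightarrow> int \<Rightarrow> int \<Rightarrow> int \<Rightarrow> int \<Rightarrow> int" where
  "shift_d p n x y i = (i - 1) * x * p * n + x + y * p"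

definition R_set :: "int \<Rightarrow> int \<Rightarrow> int \<Rightarrow> int \<Rightarrow> int \<Rightarrow> int set" where
  "R_set p n x y i =
     (\<lambda>s. s mod (n * p ^ 3)) `
       ({p, n * p ^ 3 - p}
        \<union> {k * n * p ^ 2 + shift_d p n x y i | k. 0 \<le> k \<and> k \<le> p - 1}
        \<union> {k * n * p ^ 2 - shift_d p n x y i | k. 1 \<le> k \<and> k \<le> p})"

end

theory Submission imports Defs
begin

text \<open>
  Since \<open>k\<close> runs through all residues modulo \<open>p\<close>, the set \<open>R\<^sub>i\<close> consists of \<open>\<plusminus>p\<close> modulo \<open>n * p ^ 3\<close> and of
  everything congruent to \<open>\<plusminus>d\<^sub>i\<close> modulo \<open>n * p ^ 2\<close>. The map \<open>Theta\<close> with \<open>t = j * n\<close> preserves residues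
  modulo \<open>p\<close>. Hence it fixes differences divisible by \<open>p\<close>, while a difference congruent to \<open>\<plusminus>d\<^sub>i\<close> is
  congruent to \<open>\<plusminus>x\<close> modulo \<open>p\<close> and is therefore shifted by \<open>\<plusminus>x * j * n * p\<close> modulo \<open>n * p ^ 2\<close>, which
  turns \<open>d\<^sub>i\<close> into \<open>d\<^sub>i\<^sub>+\<^sub>j\<close>.

  If multiplication by \<open>a\<close> maps \<open>R\<^sub>i\<close> onto \<open>R\<^sub>j\<close>, then \<open>a * p\<close> must be \<open>\<plusminus>p\<close>, the only multiples of \<open>p\<close> in
  \<open>R\<^sub>j\<close>. So \<open>a\<close> is \<open>\<plusminus>1\<close> modulo \<open>n * p ^ 2\<close>, and \<open>d\<^sub>i\<close> is congruent to \<open>\<plusminus>d\<^sub>j\<close> modulo \<open>n * p ^ 2\<close>, which forces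
  \<open>i = j\<close>.
\<close>

section \<open>The sets \<open>R_i\<close> as congruence conditions\<close>

text \<open>Defined on all integers, not only on residues, so that shifts of \<open>s\<close> and
  \<open>d\<close> can be computed without reducing modulo \<open>n * p ^ 3\<close>.\<close>

definition conn :: "int \<Rightarrow> int \<Rightarrow> int \<Rightarrow> int \<Rightarrow> bool" where
  "conn p n d s \<longleftrightarrow> n * p ^ 3 dvd s - p \<or> n * p ^ 3 dvd s + p \<or>
     n * p ^ 2 dvd s - d \<or> n * p ^ 2 dvd s + d"

lemma conn_mod:
  "conn p n d (s mod (n * p ^ 3)) \<longleftrightarrow> conn p n d s"
proof -
  obtain k where k: "s mod (n * p ^ 3) = s + n * p ^ 3 * k"
    by (metis add.inverse_inverse add_uminus_conv_diff minus_mult_div_eq_mod mult_minus_right)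
  have *: "n * p ^ 3 * k = n * p ^ 2 * (p * k)"
    by (simp add: power2_eq_square power3_eq_cube)
  have "n * p ^ 3 dvd s + n * p ^ 3 * k + e \<longleftrightarrow> n * p ^ 3 dvd s + e" for e
    using dvd_add_right_iff[OF dvd_triv_left, of "n * p ^ 3" k "s + e"] by (simp add: algebra_simps)
  moreover have "n * p ^ 2 dvd s + n * p ^ 3 * k + e \<longleftrightarrow> n * p ^ 2 dvd s + e" for e
    using dvd_add_right_iff[OF dvd_triv_left, of "n * p ^ 2" "p * k" "s + e"]
    unfolding * by (simp add: algebra_simps)
  ultimately show ?thesis
    unfolding conn_def k diff_conv_add_uminus by (simp only:)
qed

lemma conn_uminus: "conn p n d (- s) \<longleftrightarrow> conn p n d s"
proof -
  have "a dvd - s - b \<longleftrightarrow> a dvd s + b" "a dvd - s + b \<longleftrightarrow> a dvd s - b" for a b :: int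
    using dvd_minus_iff[of a "s + b"] dvd_minus_iff[of a "s - b"] by simp_all
  then show ?thesis by (auto simp: conn_def)
qed

text \<open>Needed when an index wraps around modulo \<open>p\<close>: this changes \<open>d\<close>
  by a multiple of \<open>n * p ^ 2\<close>.\<close>

lemma conn_cong_shift:
  assumes "n * p ^ 2 dvd d - d'"
  shows "conn p n d s \<longleftrightarrow> conn p n d' s"
proof -
  have "n * p ^ 2 dvd s - d \<longleftrightarrow> n * p ^ 2 dvd s - d'"
    using dvd_add_right_iff[OF assms, of "s - d"] by simp
  moreover have "n * p ^ 2 dvd s + d \<longleftrightarrow> n * p ^ 2 dvd s + d'"
    using dvd_add_right_iff[OF assms, of "s + d'"] by (simp add: algebra_simps)
  ultimately show ?thesis by (simp add: conn_def)
qed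

lemma mod_mem_R_set_iff:
  assumes "p > 0"
  shows "s mod (n * p ^ 3) \<in> R_set p n x y i \<longleftrightarrow> conn p n (shift_d p n x y i) s"
    (is "?L \<longleftrightarrow> conn p n ?d s")
proof
  assume ?L
  then obtain e where e: "s mod (n * p ^ 3) = e mod (n * p ^ 3)"
    and mem: "e \<in> {p, n * p ^ 3 - p} \<union> {k * n * p ^ 2 + ?d | k. 0 \<le> k \<and> k \<le> p - 1}
        \<union> {k * n * p ^ 2 - ?d | k. 1 \<le> k \<and> k \<le> p}"
    unfolding R_set_def by blast
  have "conn p n ?d e"
    using mem unfolding conn_def by auto
  then show "conn p n ?d s" by (metis conn_mod e)
next
  assume "conn p n ?d s"
  then consider "n * p ^ 3 dvd s - p" | "n * p ^ 3 dvd s + p"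
    | c where "s = ?d + n * p ^ 2 * c" | c where "s = - ?d + n * p ^ 2 * c"
    unfolding conn_def dvd_def by (auto simp: algebra_simps)
  then have "\<exists>e \<in> {p, n * p ^ 3 - p} \<union> {k * n * p ^ 2 + ?d | k. 0 \<le> k \<and> k \<le> p - 1}
        \<union> {k * n * p ^ 2 - ?d | k. 1 \<le> k \<and> k \<le> p}. n * p ^ 3 dvd s - e"
  proof cases
    case 1
    then show ?thesis by blast
  next
    case 2
    then have "n * p ^ 3 dvd s - (n * p ^ 3 - p)"
      by (metis add.commute diff_diff_eq2 dvd_diff dvd_refl)
    then show ?thesis by blast
  next
    \<comment> \<open>Reducing \<open>c\<close> modulo \<open>p\<close> changes \<open>s\<close> by
      a multiple of \<open>n * p ^ 3\<close> and gives an admissible \<open>k\<close>.\<close>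
    case (3 c)
    have "s - (c mod p * n * p ^ 2 + ?d) = n * p ^ 2 * (c - c mod p)"
      by (simp add: 3 algebra_simps)
    also have "\<dots> = n * p ^ 3 * (c div p)"
      by (simp add: minus_mod_eq_mult_div power2_eq_square power3_eq_cube)
    finally have "n * p ^ 3 dvd s - (c mod p * n * p ^ 2 + ?d)" by simp
    moreover have "0 \<le> c mod p" "c mod p \<le> p - 1"
      using assms by simp_all
    ultimately show ?thesis by blast
  next
    \<comment> \<open>Here \<open>k\<close> ranges over \<open>1..p\<close>, so the representative
      of \<open>c\<close> is \<open>(c - 1) mod p + 1\<close> in place of
      \<open>c mod p\<close>.\<close>
    case (4 c)
    have "s - (((c - 1) mod p + 1) * n * p ^ 2 - ?d) = n * p ^ 2 * (c - 1 - (c - 1) mod p)"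
      by (simp add: 4 algebra_simps)
    also have "\<dots> = n * p ^ 3 * ((c - 1) div p)"
      by (simp add: minus_mod_eq_mult_div power2_eq_square power3_eq_cube)
    finally have "n * p ^ 3 dvd s - (((c - 1) mod p + 1) * n * p ^ 2 - ?d)" by simp
    moreover have "1 \<le> (c - 1) mod p + 1" "(c - 1) mod p + 1 \<le> p"
      using assms by (simp_all add: add1_zle_eq)
    ultimately show ?thesis by blast
  qed
  then show ?L
    unfolding R_set_def image_iff mod_eq_dvd_iff .
qed

lemma mem_R_set_iff:
  assumes "p > 0" "n > 0"
  shows "s \<in> R_set p n x y i \<longleftrightarrow> s \<in> residue_set (n * p ^ 3) \<and> conn p n (shift_d p n x y i) s"
proof -
  have "n * p ^ 3 > 0" using assms by simp
  then have "R_set p n x y i \<subseteq> residue_set (n * p ^ 3)"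
    by (auto simp: R_set_def residue_set_def)
  moreover have "s mod (n * p ^ 3) = s" if "s \<in> residue_set (n * p ^ 3)"
    using that by (simp add: residue_set_def)
  ultimately show ?thesis
    using mod_mem_R_set_iff[OF assms(1), of s n x y i] by auto
qed

lemma connection_set_R_set:
  assumes "p > 0" "n > 0"
  shows "connection_set (n * p ^ 3) (R_set p n x y i)"
proof -
  let ?N = "n * p ^ 3" and ?R = "R_set p n x y i"
  have N: "?N > 0" using assms by simp
  have closed: "(- s) mod ?N \<in> ?R" if "s \<in> ?R" for s
    using that assms by (simp add: mem_R_set_iff conn_mod conn_uminus residue_set_def)
  \<comment> \<open>Negation is an involution on residues, so closure under it already yields
    equality with the image.\<close>
  have "s = (- ((- s) mod ?N)) mod ?N" if "s \<in> ?R" for s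
    using that assms by (simp add: mem_R_set_iff residue_set_def mod_minus_eq)
  then have "?R = (\<lambda>s. (- s) mod ?N) ` ?R"
    using closed by blast
  then show ?thesis
    using assms by (auto simp: connection_set_def mem_R_set_iff)
qed

section \<open>Images of circulant graphs under \<open>Theta\<close>\<close>

lemma Theta_graph_circulant_graph:
  assumes bij: "bij_betw (Theta N r t) (residue_set N) (residue_set N)"
    and iff: "\<And>u v. \<lbrakk>u \<in> residue_set N; v \<in> residue_set N\<rbrakk> \<Longrightarrow>
      (Theta N r t u - Theta N r t v) mod N \<in> S \<longleftrightarrow> (u - v) mod N \<in> R"
  shows "Theta_graph N r t (circulant_graph N R) = circulant_graph N S"
proof -
  let ?f = "Theta N r t" and ?Z = "residue_set N"
  have "{{?f u, ?f v} | u v. {u, v} \<in> snd (circulant_graph N R)}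
      = {{?f u, ?f v} | u v. u \<in> ?Z \<and> v \<in> ?Z \<and> (u - v) mod N \<in> R}" (is "?A = ?B")
  proof
    show "?A \<subseteq> ?B"
    proof
      fix e assume "e \<in> ?A"
      then obtain u v u' v' where "e = {?f u, ?f v}" "{u, v} = {u', v'}"
        and uv: "u' \<in> ?Z" "v' \<in> ?Z" "(u' - v') mod N \<in> R"
        by (auto simp: circulant_graph_def)
      \<comment> \<open>The two pairs may agree in swapped order; the image edge is the
        same.\<close>
      then have "e = {?f u', ?f v'}" by (auto simp: doubleton_eq_iff)
      with uv show "e \<in> ?B" by blast
    qed
    show "?B \<subseteq> ?A" by (auto simp: circulant_graph_def)
  qed
  also have "\<dots> = {{?f u, ?f v} | u v. u \<in> ?Z \<and> v \<in> ?Z \<and> (?f u - ?f v) mod N \<in> S}"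
    using iff by blast
  also have "\<dots> = {{u, v} | u v. u \<in> ?f ` ?Z \<and> v \<in> ?f ` ?Z \<and> (u - v) mod N \<in> S}"
    by blast
  also have "?f ` ?Z = ?Z" using bij by (simp add: bij_betw_def)
  finally show ?thesis
    by (simp add: Theta_graph_def circulant_graph_def)
qed

lemma Theta_dvd:
  assumes "p > 0" "p dvd N"
  shows "Theta N p t u = (u + u mod p * t * p) mod N"
  using assms by (simp add: Theta_def gcd_proj2_if_dvd_int)

text \<open>\<open>Theta\<close> adds a multiple of \<open>p\<close> that depends only on
  \<open>u mod p\<close>. That residue survives, so the parameter \<open>- t\<close> subtracts the
  same multiple.\<close>

lemma Theta_uminus_cancel:
  assumes "p > 0" "p dvd N" "u \<in> residue_set N"
  shows "Theta N p (- t) (Theta N p t u) = u"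
proof -
  have "Theta N p t u mod p = u mod p"
    using assms by (simp add: Theta_dvd mod_mod_cancel)
  then have "Theta N p (- t) (Theta N p t u)
      = ((u + u mod p * t * p) mod N + u mod p * (- t) * p) mod N"
    using assms(1,2) by (simp add: Theta_dvd)
  also have "\<dots> = u mod N" by (simp add: mod_add_left_eq mod_diff_left_eq)
  finally show ?thesis using assms(3) by (simp add: residue_set_def)
qed

lemma bij_betw_Theta:
  assumes "p > 0" "p dvd N" "N > 0"
  shows "bij_betw (Theta N p t) (residue_set N) (residue_set N)"
proof (rule bij_betw_byWitness[where f' = "Theta N p (- t)"])
  show "\<forall>u \<in> residue_set N. Theta N p (- t) (Theta N p t u) = u"
    using assms Theta_uminus_cancel by blast
  show "\<forall>u \<in> residue_set N. Theta N p t (Theta N p (- t) u) = u"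
    using assms Theta_uminus_cancel[of p N _ "- t"] by simp
  show "Theta N p t ` residue_set N \<subseteq> residue_set N"
    "Theta N p (- t) ` residue_set N \<subseteq> residue_set N"
    using assms by (auto simp: Theta_dvd residue_set_def)
qed

section \<open>Action of \<open>Theta\<close> on differences of vertices\<close>

lemma conn_not_dvd:
  assumes "conn p n d s" "\<not> p dvd s"
  shows "n * p ^ 2 dvd s - d \<or> n * p ^ 2 dvd s + d"
proof -
  have "p dvd s" if "n * p ^ 3 dvd s - p \<or> n * p ^ 3 dvd s + p"
  proof -
    have "p dvd n * p ^ 3" by simp
    then have "p dvd s - p \<or> p dvd s + p" using that dvd_trans by blast
    then show ?thesis by (simp add: dvd_diff_left_iff)
  qed
  then show ?thesis using assms unfolding conn_def by blast
qed

text \<open>The number \<open>c\<close> will be the difference of two residues modulo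
  \<open>p\<close>; it may be negative, hence the bound on its absolute value.\<close>

lemma conn_shift:
  assumes c: "p dvd s - c" "\<bar>c\<bar> < p" and d: "p dvd d - x" and conn: "conn p n d s"
  shows "conn p n (d + x * j * n * p) (s + c * j * n * p)"
proof -
  have p2: "p dvd n * p ^ 2" by simp
  consider "p dvd s" "n * p ^ 3 dvd s - p \<or> n * p ^ 3 dvd s + p"
    | "n * p ^ 2 dvd s - d" | "n * p ^ 2 dvd s + d"
    using conn conn_not_dvd[OF conn] unfolding conn_def by blast
  then show ?thesis
  proof cases
    case 1
    \<comment> \<open>Then \<open>c = 0\<close>, so \<open>s\<close> does not move, and the
      conditions modulo \<open>n * p ^ 3\<close> do not involve \<open>d\<close>.\<close>
    then have "p dvd c" using c(1) by (metis dvd_diff_right_iff)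
    then have "c = 0" using c(2) dvd_imp_le_int[of c p] by force
    then show ?thesis using 1 by (auto simp: conn_def)
  next
    case 2
    have "p dvd (s - d) - (s - c) + (d - x)"
      using c(1) d dvd_trans[OF p2 2] by (meson dvd_add dvd_diff)
    \<comment> \<open>Hence the shifts of \<open>s\<close> and \<open>d\<close> agree modulo
      \<open>n * p ^ 2\<close>; in the next case they are opposite.\<close>
    then have "p dvd c - x" by simp
    then have "p * (n * p) dvd (c - x) * (n * p)" by (rule mult_dvd_mono) simp
    then have "n * p ^ 2 dvd (c - x) * (n * p) * j"
      by (simp add: power2_eq_square mult_ac)
    with 2 have "n * p ^ 2 dvd (s - d) + (c - x) * (n * p) * j" by (rule dvd_add)
    then show ?thesis by (simp add: conn_def algebra_simps)
  next
    case 3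
    have "p dvd (s + d) - (s - c) - (d - x)"
      using c(1) d dvd_trans[OF p2 3] by (meson dvd_diff)
    then have "p dvd c + x" by simp
    then have "p * (n * p) dvd (c + x) * (n * p)" by (rule mult_dvd_mono) simp
    then have "n * p ^ 2 dvd (c + x) * (n * p) * j"
      by (simp add: power2_eq_square mult_ac)
    with 3 have "n * p ^ 2 dvd (s + d) + (c + x) * (n * p) * j" by (rule dvd_add)
    then show ?thesis by (simp add: conn_def algebra_simps)
  qed
qed

text \<open>Both \<open>s\<close> and \<open>d\<close> move by multiples of \<open>p\<close>, so the
  same \<open>c\<close> and \<open>x\<close> serve for shifting back with
  \<open>- j\<close>.\<close>

lemma conn_shift_iff:
  assumes c: "p dvd s - c" "\<bar>c\<bar> < p" and d: "p dvd d - x"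
  shows "conn p n (d + x * j * n * p) (s + c * j * n * p) \<longleftrightarrow> conn p n d s"
proof
  assume *: "conn p n (d + x * j * n * p) (s + c * j * n * p)"
  have "p dvd (s - c) + c * j * n * p" "p dvd (d - x) + x * j * n * p"
    using c(1) d by simp_all
  then have "p dvd s + c * j * n * p - c" "p dvd d + x * j * n * p - x"
    by (simp_all add: algebra_simps)
  from conn_shift[OF this(1) c(2) this(2) *, of "- j"] show "conn p n d s"
    by simp
qed (rule conn_shift[OF assms])

lemma Theta_mem_R_set_iff:
  assumes "p > 0" "n > 0"
  shows "(Theta (n * p ^ 3) p (j * n) u - Theta (n * p ^ 3) p (j * n) v) mod (n * p ^ 3)
           \<in> R_set p n x y ((i + j - 1) mod p + 1)
         \<longleftrightarrow> (u - v) mod (n * p ^ 3) \<in> R_set p n x y i"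
proof -
  let ?N = "n * p ^ 3" and ?d = "shift_d p n x y"
  define c where "c = u mod p - v mod p"
  have "p dvd u - v - (u mod p - v mod p)"
    by (simp add: mod_eq_dvd_iff[symmetric] mod_diff_eq)
  then have c: "p dvd u - v - c" by (simp add: c_def)
  have "\<bar>c\<bar> < p"
    using assms(1) pos_mod_bound[of p u] pos_mod_bound[of p v] pos_mod_sign[of p u]
      pos_mod_sign[of p v] unfolding c_def by linarith
  moreover have "?d i - x = p * ((i - 1) * x * n + y)"
    by (simp add: shift_d_def algebra_simps)
  then have "p dvd ?d i - x" by simp
  ultimately have *: "conn p n (?d i + x * j * n * p) (u - v + c * j * n * p) \<longleftrightarrow>
      conn p n (?d i) (u - v)"
    using c by (intro conn_shift_iff)
  \<comment> \<open>Reducing the index into \<open>1..p\<close> changes it by a multiple of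
    \<open>p\<close>, and each \<open>p\<close> contributes \<open>x * n * p ^ 2\<close> to
    \<open>?d\<close>.\<close>
  have "?d ((i + j - 1) mod p + 1) - (?d i + x * j * n * p)
      = - (x * n * p * (i + j - 1 - (i + j - 1) mod p))"
    by (simp add: shift_d_def algebra_simps)
  also have "\<dots> = n * p ^ 2 * (- (x * ((i + j - 1) div p)))"
    unfolding minus_mod_eq_mult_div by (simp add: power2_eq_square)
  finally have "n * p ^ 2 dvd ?d ((i + j - 1) mod p + 1) - (?d i + x * j * n * p)"
    by simp
  note shift = conn_cong_shift[OF this]
  have "(Theta ?N p (j * n) u - Theta ?N p (j * n) v) mod ?N
      = (u - v + c * j * n * p) mod ?N"
    using assms by (simp add: Theta_dvd mod_diff_eq c_def algebra_simps)
  then show ?thesis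
    using assms by (simp add: mod_mem_R_set_iff shift *)
qed

section \<open>Failure of Adam's isomorphism\<close>

text \<open>The difference is \<open>n * p * (i - j) * x\<close>, where \<open>p\<close> divides
  neither \<open>i - j\<close> nor \<open>x\<close>. The sum is \<open>2 * x\<close> modulo
  \<open>p\<close>, which is nonzero because \<open>p\<close> is odd.\<close>

lemma shift_d_not_cong:
  assumes "prime p" "odd p" "n > 0" "1 \<le> x" "x \<le> p - 1"
    and "i \<in> {1..p}" "j \<in> {1..p}" "i \<noteq> j"
  shows "\<not> n * p ^ 2 dvd shift_d p n x y i - shift_d p n x y j"
    and "\<not> n * p ^ 2 dvd shift_d p n x y i + shift_d p n x y j"
proof -
  have p: "p > 0" using assms(1) by (simp add: prime_gt_0_int)
  have x: "\<not> p dvd x" using assms(4,5) zdvd_not_zless by auto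
  have ij: "\<not> p dvd i - j"
    using assms(6-8) dvd_imp_le_int[of "i - j" p] by auto
  show "\<not> n * p ^ 2 dvd shift_d p n x y i - shift_d p n x y j"
  proof
    assume "n * p ^ 2 dvd shift_d p n x y i - shift_d p n x y j"
    then have "(n * p) * p dvd (n * p) * ((i - j) * x)"
      by (simp add: shift_d_def power2_eq_square algebra_simps)
    then have "p dvd (i - j) * x" using p assms(3) by simp
    then show False using x ij assms(1) by (simp add: prime_dvd_mult_iff)
  qed
  show "\<not> n * p ^ 2 dvd shift_d p n x y i + shift_d p n x y j"
  proof
    assume "n * p ^ 2 dvd shift_d p n x y i + shift_d p n x y j"
    then have "p dvd shift_d p n x y i + shift_d p n x y j"
      by (rule dvd_trans[rotated]) simp
    also have "shift_d p n x y i + shift_d p n x y j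
        = p * ((i + j - 2) * x * n + 2 * y) + 2 * x"
      by (simp add: shift_d_def algebra_simps)
    finally have "p dvd 2 * x" by (simp add: dvd_add_right_iff)
    then have "p dvd 2" using x assms(1) by (simp add: prime_dvd_mult_iff)
    then have "p \<le> 2" by (simp add: zdvd_imp_le)
    then show False using assms(1,2) prime_ge_2_int[of p] by simp
  qed
qed

lemma conn_dvd:
  assumes "conn p n d s" "p dvd s" "\<not> p dvd d"
  shows "n * p ^ 3 dvd s - p \<or> n * p ^ 3 dvd s + p"
proof -
  have "p dvd d" if "n * p ^ 2 dvd s - d \<or> n * p ^ 2 dvd s + d"
  proof -
    have "p dvd n * p ^ 2" by simp
    then have "p dvd s - d \<or> p dvd s + d" using that dvd_trans by blast
    then show ?thesis using assms(2) by (simp add: dvd_diff_right_iff dvd_add_right_iff)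
  qed
  then show ?thesis using assms unfolding conn_def by blast
qed

lemma shift_d_not_dvd:
  assumes "1 \<le> x" "x \<le> p - 1"
  shows "\<not> p dvd shift_d p n x y i"
proof
  assume "p dvd shift_d p n x y i"
  also have "shift_d p n x y i = p * ((i - 1) * x * n + y) + x"
    by (simp add: shift_d_def algebra_simps)
  finally have "p dvd x" by (simp add: dvd_add_right_iff)
  then show False using assms zdvd_not_zless by auto
qed

lemma not_adam_isomorphic_R_set:
  assumes "prime p" "odd p" "n > 0" "1 \<le> x" "x \<le> p - 1"
    and "i \<in> {1..p}" "j \<in> {1..p}" "i \<noteq> j"
  shows "\<not> adam_isomorphic (n * p ^ 3) (R_set p n x y i) (R_set p n x y j)"
proof
  let ?N = "n * p ^ 3" and ?M = "n * p ^ 2" and ?d = "shift_d p n x y"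
  assume "adam_isomorphic ?N (R_set p n x y i) (R_set p n x y j)"
  then obtain a where a: "coprime a ?N"
    and eq: "R_set p n x y j = (\<lambda>s. (a * s) mod ?N) ` R_set p n x y i"
    unfolding adam_isomorphic_def by blast
  have p: "p > 0" using assms(1) by (simp add: prime_gt_0_int)
  have d: "\<not> p dvd ?d k" for k using assms(4,5) by (rule shift_d_not_dvd)
  have image: "conn p n (?d j) (a * s)" if "conn p n (?d i) s" for s
  proof -
    have "s mod ?N \<in> R_set p n x y i"
      using that p by (simp add: mod_mem_R_set_iff)
    then have "(a * (s mod ?N)) mod ?N \<in> R_set p n x y j" using eq by blast
    then show ?thesis using p by (simp add: mod_mult_right_eq mod_mem_R_set_iff)
  qed
  have "conn p n (?d j) (a * p)" by (rule image) (simp add: conn_def)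
  then have "?N dvd a * p - p \<or> ?N dvd a * p + p"
    using d by (auto dest: conn_dvd)
  then have "p * ?M dvd p * (a - 1) \<or> p * ?M dvd p * (a + 1)"
    by (simp add: power2_eq_square power3_eq_cube algebra_simps)
  then have a1: "?M dvd a - 1 \<or> ?M dvd a + 1" using p by simp
  \<comment> \<open>This keeps \<open>a * ?d i\<close> away from the multiples of \<open>p\<close>,
    so it must be plus or minus \<open>?d j\<close> modulo \<open>?M\<close>.\<close>
  have "\<not> p dvd a"
  proof
    assume "p dvd a"
    moreover have "p dvd ?N" by simp
    ultimately have "p dvd 1" using a coprime_common_divisor by blast
    then show False using assms(1) not_prime_unit by blast
  qed
  then have "\<not> p dvd a * ?d i" using d assms(1) by (simp add: prime_dvd_mult_iff)
  moreover have "conn p n (?d j) (a * ?d i)" by (rule image) (simp add: conn_def)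
  ultimately have "?M dvd a * ?d i - ?d j \<or> ?M dvd a * ?d i + ?d j"
    by (intro conn_not_dvd)
  \<comment> \<open>Replaces \<open>a\<close> by 1, and below by -1; \<open>e\<close> stands for
    \<open>?d j\<close> or \<open>- ?d j\<close>.\<close>
  moreover have "?M dvd (a * ?d i + e) \<longleftrightarrow> ?M dvd (?d i + e)" if "?M dvd a - 1" for e
    using dvd_add_right_iff[OF dvd_mult2[OF that, of "?d i"], of "?d i + e"]
    by (simp add: algebra_simps)
  moreover have "?M dvd (a * ?d i + e) \<longleftrightarrow> ?M dvd (?d i - e)" if "?M dvd a + 1" for e
    using dvd_diff_right_iff[OF dvd_mult2[OF that, of "?d i"], of "?d i - e"]
    by (simp add: algebra_simps)
  ultimately have "?M dvd ?d i - ?d j \<or> ?M dvd ?d i + ?d j"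
    using a1 by (metis diff_conv_add_uminus diff_minus_eq_add)
  then show False using shift_d_not_cong[OF assms] by blast
qed

text \<open>Equal sets would be Adam's isomorphic with multiplier 1.\<close>

lemma R_set_neq:
  assumes "prime p" "odd p" "n > 0" "1 \<le> x" "x \<le> p - 1"
    and "i \<in> {1..p}" "j \<in> {1..p}" "i \<noteq> j"
  shows "R_set p n x y i \<noteq> R_set p n x y j"
proof
  assume eq: "R_set p n x y i = R_set p n x y j"
  have "(\<lambda>s. (1 * s) mod (n * p ^ 3)) ` R_set p n x y i = R_set p n x y i"
    unfolding R_set_def image_image by simp
  with eq have "adam_isomorphic (n * p ^ 3) (R_set p n x y i) (R_set p n x y j)"
    unfolding adam_isomorphic_def by (intro exI[of _ 1]) simp
  then show False using not_adam_isomorphic_R_set[OF assms] by blast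
qed

section \<open>Cardinalities of the connection sets\<close>

text \<open>\<open>Theta\<close> fixes 0, so its effect on differences, taken with second vertex 0,
  shows that it maps one set bijectively onto the other.\<close>

lemma card_R_set_shift:
  assumes "p > 0" "n > 0"
  shows "card (R_set p n x y ((i + j - 1) mod p + 1)) = card (R_set p n x y i)"
proof -
  let ?N = "n * p ^ 3" and ?j = "(i + j - 1) mod p + 1"
  let ?f = "Theta ?N p (j * n)"
  have N: "?N > 0" "p dvd ?N" using assms by simp_all
  have bij: "bij_betw ?f (residue_set ?N) (residue_set ?N)"
    using assms(1) N by (intro bij_betw_Theta)
  have mem: "?f s \<in> R_set p n x y ?j \<longleftrightarrow> s \<in> R_set p n x y i"
    if "s \<in> residue_set ?N" for s
  proof -
    have "?f 0 = 0" "?f s mod ?N = ?f s" using assms N by (simp_all add: Theta_dvd)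
    moreover have "s mod ?N = s" using that by (simp add: residue_set_def)
    ultimately show ?thesis
      using Theta_mem_R_set_iff[OF assms, of j s 0 x y i] by simp
  qed
  have sub: "R_set p n x y k \<subseteq> residue_set ?N" for k
    using assms by (auto simp: mem_R_set_iff)
  have "?f ` R_set p n x y i = R_set p n x y ?j"
  proof
    show "?f ` R_set p n x y i \<subseteq> R_set p n x y ?j" using mem sub by blast
    show "R_set p n x y ?j \<subseteq> ?f ` R_set p n x y i"
    proof
      fix r assume r: "r \<in> R_set p n x y ?j"
      then have "r \<in> ?f ` residue_set ?N" using sub bij by (auto simp: bij_betw_def)
      then obtain s where "s \<in> residue_set ?N" "r = ?f s" by blast
      then show "r \<in> ?f ` R_set p n x y i" using r mem by blast
    qed
  qed
  moreover have "inj_on ?f (R_set p n x y i)"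
    using bij sub by (meson bij_betw_def inj_on_subset)
  ultimately show ?thesis by (metis card_image)
qed

text \<open>The residues of \<open>p\<close>, \<open>- p\<close> and \<open>d_i\<close> are
  distinct: the first two because \<open>n * p ^ 3\<close> is at least \<open>3 * p\<close>, the
  third because it is not divisible by \<open>p\<close>.\<close>

lemma card_R_set_ge_3:
  assumes "prime p" "odd p" "n > 0" "1 \<le> x" "x \<le> p - 1"
  shows "card (R_set p n x y i) \<ge> 3"
proof -
  let ?N = "n * p ^ 3" and ?d = "shift_d p n x y i"
  have "p \<ge> 2" using assms(1) by (rule prime_ge_2_int)
  moreover have "p \<noteq> 2" using assms(2) by auto
  ultimately have p3: "p \<ge> 3" by linarith
  have "3 * p \<le> p ^ 2 * p" using p3 self_le_power[of p 2] by (intro mult_right_mono) auto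
  also have "\<dots> \<le> ?N" using assms(3) p3 by (simp add: power2_eq_square power3_eq_cube)
  finally have N: "?N \<ge> 3 * p" .
  have "p \<in> R_set p n x y i" "?N - p \<in> R_set p n x y i"
    using N p3 assms(3) by (simp_all add: mem_R_set_iff residue_set_def conn_def)
  moreover have "?d mod ?N \<in> R_set p n x y i"
    using p3 by (simp add: mod_mem_R_set_iff conn_def)
  ultimately have sub: "{p, ?N - p, ?d mod ?N} \<subseteq> R_set p n x y i" by simp
  have "\<not> p dvd ?d mod ?N"
    using shift_d_not_dvd[OF assms(4,5)] by (simp add: dvd_mod_iff)
  moreover have "p dvd ?N - p" by simp
  ultimately have "?d mod ?N \<noteq> p" "?d mod ?N \<noteq> ?N - p" by auto
  then have "card {p, ?N - p, ?d mod ?N} = 3" using N p3 by auto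
  moreover have "finite (R_set p n x y i)"
  proof (rule finite_subset)
    show "R_set p n x y i \<subseteq> residue_set ?N"
      using p3 assms(3) by (auto simp: mem_R_set_iff)
  qed (simp add: residue_set_def)
  ultimately show ?thesis using sub by (metis card_mono)
qed

theorem theorem2p1:
  fixes p n x y :: int
  assumes "prime p" and "odd p" and "n \<ge> 1"
    and "1 \<le> x" and "x \<le> p - 1"
    and "0 \<le> y" and "y \<le> n * p - 1"
    and "1 \<le> x + y * p" and "x + y * p \<le> n * p ^ 2 - 1"
  shows "(\<forall>i\<in>{1..p}. \<forall>j\<in>{1..p}.
            Theta_graph (n * p ^ 3) p (j * n) (circulant_graph (n * p ^ 3) (R_set p n x y i))
            = circulant_graph (n * p ^ 3) (R_set p n x y ((i + j - 1) mod p + 1)))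
       \<and> (\<forall>i\<in>{1..p}. \<forall>j\<in>{1..p}. i \<noteq> j \<longrightarrow>
            type2_isomorphic (n * p ^ 3) p (R_set p n x y i) (R_set p n x y j))"
proof -
  let ?N = "n * p ^ 3" and ?R = "R_set p n x y"
  have p: "p > 1" using assms(1) by (rule prime_gt_1_int)
  have n: "n > 0" using assms(3) by simp
  have N: "?N > 0" "p dvd ?N" using p n by simp_all
  have graph: "Theta_graph ?N p (j * n) (circulant_graph ?N (?R i))
      = circulant_graph ?N (?R ((i + j - 1) mod p + 1))" for i j
  proof (rule Theta_graph_circulant_graph)
    show "bij_betw (Theta ?N p (j * n)) (residue_set ?N) (residue_set ?N)"
      using p N by (intro bij_betw_Theta) auto
  qed (use p n in \<open>simp add: Theta_mem_R_set_iff\<close>)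
  have "type2_isomorphic ?N p (?R i) (?R j)"
    if ij: "i \<in> {1..p}" "j \<in> {1..p}" "i \<noteq> j" for i j
  proof -
    \<comment> \<open>The shift that takes index \<open>i\<close> to \<open>j\<close>; it is nonzero
      as \<open>i\<close> and \<open>j\<close> differ, so \<open>t = k * n\<close> is a valid
      parameter.\<close>
    define k where "k = (j - i) mod p"
    have "(i + k - 1) mod p = (j - 1) mod p"
      using mod_add_left_eq[of "j - i" p "i - 1"] unfolding k_def by (simp add: algebra_simps)
    also have "\<dots> = j - 1" using ij by simp
    finally have j: "(i + k - 1) mod p + 1 = j" by simp
    have "k \<noteq> 0" using j ij by auto
    moreover have "0 \<le> k" "k < p" using p by (simp_all add: k_def)
    ultimately have k: "1 \<le> k" "k < p" by simp_all
    have gcd: "gcd ?N p = p" using p N(2) by (simp add: gcd_proj2_if_dvd_int)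
    have "1 * 1 \<le> k * n" using k n by (intro mult_mono) auto
    then have "1 \<le> k * n" by simp
    moreover have "k * n < ?N div gcd ?N p"
    proof -
      have "k * n < p * n" using k n by simp
      also have "\<dots> \<le> p * n * p" using p n by simp
      also have "\<dots> = ?N div p" using p by (simp add: power3_eq_cube)
      finally show ?thesis by (simp add: gcd)
    qed
    ultimately have "\<exists>t. 1 \<le> t \<and> t \<le> ?N div gcd ?N p - 1 \<and>
        Theta_graph ?N p t (circulant_graph ?N (?R i)) = circulant_graph ?N (?R j)"
      using graph[of k i] j by (intro exI[of _ "k * n"]) simp
    moreover have "card (?R i) = card (?R j)"
      using card_R_set_shift[of p n x y i k] p n j by simp
    ultimately show ?thesis
      unfolding type2_isomorphic_def
      using p n N gcd ij assms(1,2,4,5) connection_set_R_set R_set_neq card_R_set_ge_3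
        not_adam_isomorphic_R_set by auto
  qed
  with graph show ?thesis by blast
qed

end
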